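(* Consider a bipartite network coordination game with player groups $\mathcal N_1=\{1,\dots,n\}$ and $\mathcal N_2=\{1,\dots,m\}$, real payoff matrices $A^{ij}$ ($i\in\mathcal N_1$, $j\in\mathcal N_2$) of size $k_i\times l_j$, and learning rates $\eta_1,\eta_2>0$. Let $\mathbf x_i\in\mathbb R^{k_i}$ and $\mathbf y_j\in\mathbb R^{l_j}$ be the strategies, and suppose they are updated by $$\mathbf x_i^{t+1}=\mathbf x_i^t+\eta_1\sum_{j=1}^m A^{ij}\mathbf y_j^t\quad(1\le i\le n),\qquad \mathbf y_j^{t+1}=\mathbf y_j^t+\eta_2\sum_{i=1}^n (A^{ij})^{\top}\mathbf x_i^{t+1}\quad(1\le j\le m).$$ Writing $X=(\mathbf x_1,\dots,\mathbf x_n)$ and $Y=(\mathbf y_1,\dots,\mathbf y_m)$, the function $$\Phi(X,Y)=\frac1{\eta_1}\sum_{i=1}^n\|\mathbf x_i\|^2-\frac1{\eta_2}\sum_{j=1}^m\|\mathbf y_j\|^2+\sum_{i=1}^n\sum_{j=1}^m\langle \mathbf x_i,A^{ij}\mathbf y_j\rangle$$ is invariant under this update, i.e. $\Phi(X^{t+1},Y^{t+1})=\Phi(X^t,Y^t)$ for all $(X^t,Y^t)$.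
   Context: $\|\cdot\|$ is the Euclidean norm and $\langle\cdot,\cdot\rangle$ the Euclidean inner product. The update rule in the claim is called the alternating gradient descent/ascent (alternating play) update. *)

theory Defs
  imports Complex_Main "Jordan_Normal_Form.Matrix"
begin

text \<open>The dimensions \<open>k i\<close> and \<open>l j\<close> vary with the player, so strategies are dimension-carrying
  vectors of \<open>Jordan_Normal_Form.Matrix\<close>; a strategy profile is a function on player indices,
  of which only the values on \<open>{1..n}\<close> (resp. \<open>{1..m}\<close>) matter.\<close>

abbreviation vec_sum :: "nat \<Rightarrow> (nat \<Rightarrow> real vec) \<Rightarrow> nat set \<Rightarrow> real vec" where
  "vec_sum d \<equiv> finsum_vec TYPE(real) d"

definition eucl_norm :: "real vec \<Rightarrow> real" where
  "eucl_norm v = sqrt (v \<bullet> v)"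

text \<open>One step of alternating play from \<open>(X, Y)\<close> to \<open>(X', Y')\<close>: the second group reacts to the
  already updated strategies \<open>X'\<close> of the first group.\<close>

definition alternating_play_update ::
  "real \<Rightarrow> real \<Rightarrow> nat \<Rightarrow> nat \<Rightarrow> (nat \<Rightarrow> nat) \<Rightarrow> (nat \<Rightarrow> nat) \<Rightarrow> (nat \<Rightarrow> nat \<Rightarrow> real mat) \<Rightarrow>
   (nat \<Rightarrow> real vec) \<Rightarrow> (nat \<Rightarrow> real vec) \<Rightarrow> (nat \<Rightarrow> real vec) \<Rightarrow> (nat \<Rightarrow> real vec) \<Rightarrow> bool" where
  "alternating_play_update \<eta>1 \<eta>2 n m k l A X Y X' Y' \<longleftrightarrow>
     (\<forall>i\<in>{1..n}. X' i = X i + \<eta>1 \<cdot>\<^sub>v vec_sum (k i) (\<lambda>j. A i j *\<^sub>v Y j) {1..m}) \<and>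
     (\<forall>j\<in>{1..m}. Y' j = Y j + \<eta>2 \<cdot>\<^sub>v vec_sum (l j) (\<lambda>i. transpose_mat (A i j) *\<^sub>v X' i) {1..n})"

definition Phi ::
  "real \<Rightarrow> real \<Rightarrow> nat \<Rightarrow> nat \<Rightarrow> (nat \<Rightarrow> nat \<Rightarrow> real mat) \<Rightarrow>
   (nat \<Rightarrow> real vec) \<Rightarrow> (nat \<Rightarrow> real vec) \<Rightarrow> real" where
  "Phi \<eta>1 \<eta>2 n m A X Y =
     1 / \<eta>1 * (\<Sum>i=1..n. (eucl_norm (X i))\<^sup>2)
     - 1 / \<eta>2 * (\<Sum>j=1..m. (eucl_norm (Y j))\<^sup>2)
     + (\<Sum>i=1..n. \<Sum>j=1..m. X i \<bullet> (A i j *\<^sub>v Y j))"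

end

theory Submission
  imports Defs
begin

text \<open>Let \<open>B(X, Y)\<close> be the bilinear form in \<open>Phi\<close>. Since \<open>|x'|\<^sup>2 - |x|\<^sup>2 = (x' - x) \<bullet> (x + x')\<close>, the first
  half-step changes \<open>\<Sum>|x\<^sub>i|\<^sup>2 / \<eta>1\<close> by \<open>B(X, Y) + B(X', Y)\<close> and the second changes
  \<open>\<Sum>|y\<^sub>j|\<^sup>2 / \<eta>2\<close> by \<open>B(X', Y) + B(X', Y')\<close>. The difference \<open>B(X, Y) - B(X', Y')\<close> is cancelled by
  the change of \<open>B\<close>.\<close>

lemma vec_sum_carrier:
  assumes "finite S" and "\<And>s. s \<in> S \<Longrightarrow> f s \<in> carrier_vec d"
  shows "vec_sum d f S \<in> carrier_vec d"
  using assms by (intro finsum_vec_closed) auto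

lemma scalar_prod_vec_sum:
  assumes "finite S" and "\<And>s. s \<in> S \<Longrightarrow> f s \<in> carrier_vec d" and v: "v \<in> carrier_vec d"
  shows "v \<bullet> vec_sum d f S = (\<Sum>s\<in>S. v \<bullet> f s)"
  using assms(1,2)
proof (induction S)
  case empty
  show ?case using v by (simp add: finsum_vec_empty)
next
  case (insert s S)
  have S: "vec_sum d f S \<in> carrier_vec d"
    using insert.hyps insert.prems by (intro vec_sum_carrier) auto
  have "vec_sum d f (insert s S) = f s + vec_sum d f S"
    using insert by (intro finsum_vec_insert) auto
  then show ?case
    using insert S v by (simp add: scalar_prod_add_distrib[of _ d])
qed

lemma eucl_norm_square: "(eucl_norm v)\<^sup>2 = v \<bullet> v"
  by (simp add: eucl_norm_def scalar_prod_def sum_nonneg)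

text \<open>Divide \<open>(x' - x) \<bullet> (x' + x)\<close> by \<eta>, using
  \<open>x' - x = \<eta> \<cdot>\<^sub>v g\<close>. Keeping both endpoints \<open>x\<close> and
  \<open>x'\<close> on the right absorbs the term quadratic in \<open>g\<close>, so only terms
  linear in \<open>g\<close> remain.\<close>

lemma eucl_norm_square_step:
  assumes x: "x \<in> carrier_vec d" and g: "g \<in> carrier_vec d" and "\<eta> \<noteq> 0"
    and x': "x' = x + \<eta> \<cdot>\<^sub>v g"
  shows "1 / \<eta> * (eucl_norm x')\<^sup>2 = 1 / \<eta> * (eucl_norm x)\<^sup>2 + x \<bullet> g + x' \<bullet> g"
proof -
  have "x' \<bullet> g = x \<bullet> g + \<eta> * (g \<bullet> g)"
    using x g by (simp add: x' add_scalar_prod_distrib[of _ d])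
  moreover have "x' \<bullet> x' = x \<bullet> x + 2 * \<eta> * (x \<bullet> g) + \<eta> * \<eta> * (g \<bullet> g)"
    using x g by (simp add: x' add_scalar_prod_distrib[of _ d] scalar_prod_add_distrib[of _ d]
        comm_scalar_prod[of g d x] algebra_simps)
  ultimately show ?thesis
    using \<open>\<eta> \<noteq> 0\<close> by (simp add: eucl_norm_square field_simps)
qed

text \<open>One half-step of play: the group \<open>I\<close> moves against a frozen profile
  \<open>Y\<close> of the group \<open>J\<close>. Index sets and matrices are arbitrary so that the
  lemma serves both groups, the second one with transposed matrices and exchanged roles.\<close>

lemma sum_eucl_norm_square_step:
  assumes "finite I" and "finite J" and "\<eta> \<noteq> 0"
    and M: "\<And>i j. i \<in> I \<Longrightarrow> j \<in> J \<Longrightarrow> M i j \<in> carrier_mat (d i) (e j)"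
    and X: "\<And>i. i \<in> I \<Longrightarrow> X i \<in> carrier_vec (d i)"
    and Y: "\<And>j. j \<in> J \<Longrightarrow> Y j \<in> carrier_vec (e j)"
    and X': "\<And>i. i \<in> I \<Longrightarrow> X' i = X i + \<eta> \<cdot>\<^sub>v vec_sum (d i) (\<lambda>j. M i j *\<^sub>v Y j) J"
  shows "1 / \<eta> * (\<Sum>i\<in>I. (eucl_norm (X' i))\<^sup>2) = 1 / \<eta> * (\<Sum>i\<in>I. (eucl_norm (X i))\<^sup>2)
    + (\<Sum>i\<in>I. \<Sum>j\<in>J. X i \<bullet> (M i j *\<^sub>v Y j)) + (\<Sum>i\<in>I. \<Sum>j\<in>J. X' i \<bullet> (M i j *\<^sub>v Y j))"
proof -
  \<comment> \<open>The identity holds for each player separately, because each moves along a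
    gradient that depends on \<open>Y\<close> only.\<close>
  have "1 / \<eta> * (eucl_norm (X' i))\<^sup>2 = 1 / \<eta> * (eucl_norm (X i))\<^sup>2
    + (\<Sum>j\<in>J. X i \<bullet> (M i j *\<^sub>v Y j)) + (\<Sum>j\<in>J. X' i \<bullet> (M i j *\<^sub>v Y j))" if i: "i \<in> I" for i
  proof -
    let ?g = "vec_sum (d i) (\<lambda>j. M i j *\<^sub>v Y j) J"
    have MY: "M i j *\<^sub>v Y j \<in> carrier_vec (d i)" if "j \<in> J" for j
      using M[OF i that] Y[OF that] by simp
    have g: "?g \<in> carrier_vec (d i)"
      using \<open>finite J\<close> MY by (intro vec_sum_carrier)
    have "X' i \<in> carrier_vec (d i)"
      using X'[OF i] X[OF i] g by simp
    then show ?thesis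
      using eucl_norm_square_step[OF X[OF i] g \<open>\<eta> \<noteq> 0\<close> X'[OF i]]
        scalar_prod_vec_sum[OF \<open>finite J\<close> MY] X[OF i] by simp
  qed
  then show ?thesis
    by (simp only: sum_distrib_left sum.distrib[symmetric] cong: sum.cong)
qed

text \<open>The transpose is the adjoint; this brings the second group's gradient terms into the
  form of the coupling term of \<open>Phi\<close>.\<close>

lemma scalar_prod_transpose:
  fixes M :: "real mat"
  assumes "M \<in> carrier_mat r c" and "x \<in> carrier_vec r" and "y \<in> carrier_vec c"
  shows "y \<bullet> (transpose_mat M *\<^sub>v x) = x \<bullet> (M *\<^sub>v y)"
  using assms comm_scalar_prod[of "transpose_mat M *\<^sub>v x" c y]
    transpose_vec_mult_scalar[of M r c y x] comm_scalar_prod[of x r "M *\<^sub>v y"]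
  by simp

theorem theorem4p1:
  fixes n m :: nat and k l :: "nat \<Rightarrow> nat"
    and A :: "nat \<Rightarrow> nat \<Rightarrow> real mat"
    and \<eta>1 \<eta>2 :: real
    and X Y X' Y' :: "nat \<Rightarrow> real vec"
  assumes "\<And>i j. i \<in> {1..n} \<Longrightarrow> j \<in> {1..m} \<Longrightarrow> A i j \<in> carrier_mat (k i) (l j)"
    and "\<eta>1 > 0" and "\<eta>2 > 0"
    and "\<And>i. i \<in> {1..n} \<Longrightarrow> X i \<in> carrier_vec (k i)"
    and "\<And>j. j \<in> {1..m} \<Longrightarrow> Y j \<in> carrier_vec (l j)"
    and "alternating_play_update \<eta>1 \<eta>2 n m k l A X Y X' Y'"
  shows "Phi \<eta>1 \<eta>2 n m A X' Y' = Phi \<eta>1 \<eta>2 n m A X Y"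
proof -
  note A = assms(1) and X = assms(4) and Y = assms(5)
  have X': "X' i = X i + \<eta>1 \<cdot>\<^sub>v vec_sum (k i) (\<lambda>j. A i j *\<^sub>v Y j) {1..m}" if "i \<in> {1..n}" for i
    using assms(6) that unfolding alternating_play_update_def by blast
  have Y': "Y' j = Y j + \<eta>2 \<cdot>\<^sub>v vec_sum (l j) (\<lambda>i. transpose_mat (A i j) *\<^sub>v X' i) {1..n}"
    if "j \<in> {1..m}" for j
    using assms(6) that unfolding alternating_play_update_def by blast
  have X'_carrier: "X' i \<in> carrier_vec (k i)" if i: "i \<in> {1..n}" for i
  proof -
    have "vec_sum (k i) (\<lambda>j. A i j *\<^sub>v Y j) {1..m} \<in> carrier_vec (k i)"
      by (intro vec_sum_carrier mult_mat_vec_carrier[OF A[OF i] Y]) auto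
    then show ?thesis
      using X'[OF i] X[OF i] by simp
  qed
  \<comment> \<open>The second group's player comes first here, matching the exchanged roles in the
    second half-step.\<close>
  have At: "transpose_mat (A i j) \<in> carrier_mat (l j) (k i)"
    if "j \<in> {1..m}" and "i \<in> {1..n}" for j i
    using A that by simp
  have Y'_carrier: "Y' j \<in> carrier_vec (l j)" if j: "j \<in> {1..m}" for j
  proof -
    have "vec_sum (l j) (\<lambda>i. transpose_mat (A i j) *\<^sub>v X' i) {1..n} \<in> carrier_vec (l j)"
      by (intro vec_sum_carrier mult_mat_vec_carrier[OF At[OF j] X'_carrier]) auto
    then show ?thesis
      using Y'[OF j] Y[OF j] by simp
  qed
  \<comment> \<open>\<open>V\<close> is left general because both the old \<open>Y\<close> and the
    new \<open>Y'\<close> are paired with \<open>X'\<close>.\<close>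
  have swap: "(\<Sum>j=1..m. \<Sum>i=1..n. V j \<bullet> (transpose_mat (A i j) *\<^sub>v X' i))
      = (\<Sum>i=1..n. \<Sum>j=1..m. X' i \<bullet> (A i j *\<^sub>v V j))"
    if V: "\<And>j. j \<in> {1..m} \<Longrightarrow> V j \<in> carrier_vec (l j)" for V
    by (subst sum.swap) (intro sum.cong refl scalar_prod_transpose[OF A X'_carrier V])
  have "1 / \<eta>1 * (\<Sum>i=1..n. (eucl_norm (X' i))\<^sup>2) = 1 / \<eta>1 * (\<Sum>i=1..n. (eucl_norm (X i))\<^sup>2)
    + (\<Sum>i=1..n. \<Sum>j=1..m. X i \<bullet> (A i j *\<^sub>v Y j)) + (\<Sum>i=1..n. \<Sum>j=1..m. X' i \<bullet> (A i j *\<^sub>v Y j))"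
    using \<open>\<eta>1 > 0\<close> by (intro sum_eucl_norm_square_step[OF _ _ _ A X Y X']) auto
  moreover
  have "1 / \<eta>2 * (\<Sum>j=1..m. (eucl_norm (Y' j))\<^sup>2) = 1 / \<eta>2 * (\<Sum>j=1..m. (eucl_norm (Y j))\<^sup>2)
    + (\<Sum>j=1..m. \<Sum>i=1..n. Y j \<bullet> (transpose_mat (A i j) *\<^sub>v X' i))
    + (\<Sum>j=1..m. \<Sum>i=1..n. Y' j \<bullet> (transpose_mat (A i j) *\<^sub>v X' i))"
    using \<open>\<eta>2 > 0\<close> by (intro sum_eucl_norm_square_step[OF _ _ _ At Y X'_carrier Y']) auto
  moreover note swap[of Y, OF Y] swap[of Y', OF Y'_carrier]
  ultimately show ?thesis
    unfolding Phi_def by linarith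
qed

end
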